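(* Let $\psi:T\to\mathbb{C}$ be a function and define $$\eta_\psi=|\psi(o)|+\sup_{v\in T^*}|v|\left[|\psi(v)|+|\psi(v^-)|\right].$$ Then the following statements are equivalent: (a) $M_\psi:L^\infty\to\mathcal{L}_{\mathbf{w}}$ is bounded. (b) $\displaystyle\sup_{v\in T}|v||\psi(v)|<\infty$. Furthermore, under these conditions, the operator norm of $M_\psi:L^\infty\to\mathcal{L}_{\mathbf{w}}$ is $\|M_\psi\|=\eta_\psi$.
   Context: $T$ is the vertex set of a tree (a locally finite, connected, simply connected graph), rooted at a vertex $o$ and without terminal vertices (a terminal vertex is one having a unique neighbor), hence infinite. $|v|$ is the number of edges in the path from $o$ to $v$; $T^*=T\setminus\{o\}$; for $v\in T^*$, $v^-$ is the neighbor of $v$ closest to $o$. For $f:T\to\mathbb{C}$ and $v\in T^*$, $Df(v)=|f(v)-f(v^-)|$. The weighted Lipschitz space $\mathcal{L}_{\mathbf{w}}$ is the Banach space of all $f:T\to\mathbb{C}$ with $\sup_{v\in T^*}|v|Df(v)<\infty$, with norm $\|f\|_{\mathbf{w}}=|f(o)|+\sup_{v\in T^*}|v|Df(v)$. $L^\infty$ is the Banach space of bounded functions $f:T\to\mathbb{C}$ with $\|f\|_\infty=\sup_{v\in T}|f(v)|$. For $\psi:T\to\mathbb{C}$, $M_\psi f=\psi f$ (pointwise product). "$M_\psi:X\to Y$ is bounded" means that $\psi f\in Y$ for all $f\in X$ and $M_\psi$ is a bounded linear operator. *)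

theory Defs
  imports "HOL-Analysis.Analysis"
begin

text \<open>A graph is given by its adjacency relation on the vertex type \<^typ>\<open>'v\<close>; the set of all
  elements of this type plays the role of the vertex set \<open>T\<close>.\<close>

definition nbrs :: "('v \<Rightarrow> 'v \<Rightarrow> bool) \<Rightarrow> 'v \<Rightarrow> 'v set" where
  "nbrs adj v = {w. adj v w}"

definition vertex_path :: "('v \<Rightarrow> 'v \<Rightarrow> bool) \<Rightarrow> 'v \<Rightarrow> 'v list \<Rightarrow> 'v \<Rightarrow> bool" where
  "vertex_path adj u p v \<longleftrightarrow>
     p \<noteq> [] \<and> hd p = u \<and> last p = v \<and> successively adj p \<and> distinct p"

definition graph_cycle :: "('v \<Rightarrow> 'v \<Rightarrow> bool) \<Rightarrow> 'v list \<Rightarrow> bool" where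
  "graph_cycle adj c \<longleftrightarrow>
     3 \<le> length c \<and> successively adj c \<and> distinct c \<and> adj (last c) (hd c)"

definition terminal :: "('v \<Rightarrow> 'v \<Rightarrow> bool) \<Rightarrow> 'v \<Rightarrow> bool" where
  "terminal adj v \<longleftrightarrow> (\<exists>!w. w \<in> nbrs adj v)"

text \<open>For graphs, simply connected means without cycles.\<close>

definition tree :: "('v \<Rightarrow> 'v \<Rightarrow> bool) \<Rightarrow> bool" where
  "tree adj \<longleftrightarrow>
     symp adj \<and> irreflp adj \<and>
     (\<forall>v. finite (nbrs adj v)) \<and>
     (\<forall>u v. \<exists>p. vertex_path adj u p v) \<and>
     (\<nexists>c. graph_cycle adj c)"

text \<open>Infinity of the vertex set has to be required separately only in order to exclude the
  graph with a single vertex, which has no terminal vertex in the above sense.\<close>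

definition infinite_tree :: "('v \<Rightarrow> 'v \<Rightarrow> bool) \<Rightarrow> bool" where
  "infinite_tree adj \<longleftrightarrow>
     tree adj \<and> (\<nexists>v. terminal adj v) \<and> infinite (UNIV :: 'v set)"

text \<open>In a tree the path between two vertices is unique. In the following, \<open>r\<close> is the root
  (written \<open>o\<close> in the usual notation), \<open>level adj r v\<close> is \<open>|v|\<close> and \<open>parent adj r v\<close> is \<open>v\<^sup>-\<close>,
  which is meaningful for \<open>v \<noteq> r\<close> only.\<close>

definition level :: "('v \<Rightarrow> 'v \<Rightarrow> bool) \<Rightarrow> 'v \<Rightarrow> 'v \<Rightarrow> nat" where
  "level adj r v = length (THE p. vertex_path adj r p v) - 1"

definition parent :: "('v \<Rightarrow> 'v \<Rightarrow> bool) \<Rightarrow> 'v \<Rightarrow> 'v \<Rightarrow> 'v" where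
  "parent adj r v = (ARG_MIN (level adj r) w. w \<in> nbrs adj v)"

definition Dfun :: "('v \<Rightarrow> 'v \<Rightarrow> bool) \<Rightarrow> 'v \<Rightarrow> ('v \<Rightarrow> complex) \<Rightarrow> 'v \<Rightarrow> real" where
  "Dfun adj r f v = cmod (f v - f (parent adj r v))"

text \<open>Finiteness of a supremum is expressed in the extended reals. The norms are real-valued;
  they are meaningful on the respective space only, where the supremum is finite.\<close>

definition Lip_w :: "('v \<Rightarrow> 'v \<Rightarrow> bool) \<Rightarrow> 'v \<Rightarrow> ('v \<Rightarrow> complex) set" where
  "Lip_w adj r = {f. (SUP v\<in>-{r}. ereal (real (level adj r v) * Dfun adj r f v)) < \<infinity>}"

definition Lip_w_norm :: "('v \<Rightarrow> 'v \<Rightarrow> bool) \<Rightarrow> 'v \<Rightarrow> ('v \<Rightarrow> complex) \<Rightarrow> real" where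
  "Lip_w_norm adj r f = cmod (f r) + (SUP v\<in>-{r}. real (level adj r v) * Dfun adj r f v)"

definition L_inf :: "('v \<Rightarrow> complex) set" where
  "L_inf = {f. bounded (range f)}"

definition L_inf_norm :: "('v \<Rightarrow> complex) \<Rightarrow> real" where
  "L_inf_norm f = (SUP v. cmod (f v))"

text \<open>Linear operators between normed spaces of functions, each space being given by its set
  of elements and its norm.\<close>

definition bounded_operator ::
  "('v \<Rightarrow> complex) set \<Rightarrow> (('v \<Rightarrow> complex) \<Rightarrow> real) \<Rightarrow>
   ('v \<Rightarrow> complex) set \<Rightarrow> (('v \<Rightarrow> complex) \<Rightarrow> real) \<Rightarrow>
   (('v \<Rightarrow> complex) \<Rightarrow> ('v \<Rightarrow> complex)) \<Rightarrow> bool" where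
  "bounded_operator X nX Y nY A \<longleftrightarrow>
     (\<forall>f\<in>X. A f \<in> Y) \<and>
     (\<forall>f\<in>X. \<forall>g\<in>X. A (\<lambda>v. f v + g v) = (\<lambda>v. A f v + A g v)) \<and>
     (\<forall>c. \<forall>f\<in>X. A (\<lambda>v. c * f v) = (\<lambda>v. c * A f v)) \<and>
     (\<exists>C. \<forall>f\<in>X. nY (A f) \<le> C * nX f)"

definition operator_norm ::
  "('v \<Rightarrow> complex) set \<Rightarrow> (('v \<Rightarrow> complex) \<Rightarrow> real) \<Rightarrow>
   (('v \<Rightarrow> complex) \<Rightarrow> real) \<Rightarrow> (('v \<Rightarrow> complex) \<Rightarrow> ('v \<Rightarrow> complex)) \<Rightarrow> real" where
  "operator_norm X nX nY A = (SUP f\<in>{f\<in>X. nX f \<le> 1}. nY (A f))"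

definition mult_op :: "('v \<Rightarrow> complex) \<Rightarrow> ('v \<Rightarrow> complex) \<Rightarrow> 'v \<Rightarrow> complex" where
  "mult_op \<psi> f = (\<lambda>v. \<psi> v * f v)"

definition eta :: "('v \<Rightarrow> 'v \<Rightarrow> bool) \<Rightarrow> 'v \<Rightarrow> ('v \<Rightarrow> complex) \<Rightarrow> ereal" where
  "eta adj r \<psi> = ereal (cmod (\<psi> r)) +
     (SUP v\<in>-{r}. ereal (real (level adj r v) * (cmod (\<psi> v) + cmod (\<psi> (parent adj r v)))))"

end

theory Submission
  imports Defs
begin

text \<open>For \<open>\<parallel>f\<parallel>\<^sub>\<infinity> \<le> 1\<close> the triangle inequality gives \<open>|v| D(\<psi>f)(v) \<le> |v| (|\<psi>(v)| + |\<psi>(v\<^sup>-)|)\<close>. Since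
  \<open>|v|\<close> changes parity along every edge, the function \<open>f(v) = (-1)\<^bsup>|v|\<^esup> cnj (sgn (\<psi>(v)))\<close> turns all of
  these inequalities into equalities at once, so that \<open>\<eta>\<^sub>\<psi>\<close> is attained. As \<open>|v| = |v\<^sup>-| + 1\<close>, finiteness
  of \<open>\<eta>\<^sub>\<psi>\<close> amounts to boundedness of \<open>|v| |\<psi>(v)|\<close>.\<close>

section \<open>Paths and levels in trees\<close>

lemma vertex_path_last_in_set:
  assumes "vertex_path adj u p v"
  shows "v \<in> set p"
proof -
  have "p \<noteq> []" "last p = v"
    using assms unfolding vertex_path_def by auto
  then show ?thesis
    using last_in_set by blast
qed

text \<open>Follow \<open>p\<close> from \<open>a\<close> to the first vertex \<open>x\<close> that
  lies on \<open>q\<close>, return along \<open>q\<close> to \<open>b\<close> and close up through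
  \<open>u\<close>. Since \<open>x\<close> is the first meeting point, the two arms are
  disjoint.\<close>

lemma graph_cycle_if_two_paths:
  assumes "symp adj"
    and p: "vertex_path adj a p v" and q: "vertex_path adj b q v"
    and "adj u a" and "adj u b" and "a \<noteq> b" and "u \<notin> set p" and "u \<notin> set q"
  shows "\<exists>c. graph_cycle adj c"
proof -
  have "v \<in> set p" "v \<in> set q"
    using p q by (auto dest: vertex_path_last_in_set)
  then have "\<exists>x\<in>set p. x \<in> set q" ..
  then obtain p1 x p2 where p_eq: "p = p1 @ x # p2" and "x \<in> set q"
    and p1: "\<forall>y\<in>set p1. y \<notin> set q"
    by (rule split_list_first_propE)
  then obtain q1 q2 where q_eq: "q = q1 @ x # q2"
    by (meson split_list)
  define t where "t = rev q1"
  let ?c = "u # p1 @ x # t"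
  have "successively adj (u # p)"
    using p assms(4) by (simp add: vertex_path_def successively_Cons)
  then have "successively adj ((u # p1 @ [x]) @ p2)"
    by (simp add: p_eq)
  then have up: "successively adj (u # p1 @ [x])"
    unfolding successively_append_iff by blast
  have "successively adj (u # q)"
    using q assms(5) by (simp add: vertex_path_def successively_Cons)
  then have "successively adj ((u # q1 @ [x]) @ q2)"
    by (simp add: q_eq)
  then have "successively adj (u # q1 @ [x])"
    unfolding successively_append_iff by blast
  \<comment> \<open>Symmetry of \<open>adj\<close> allows the arm along \<open>q\<close> to be
    traversed backwards, from \<open>x\<close> to \<open>u\<close>.\<close>
  then have "successively (\<lambda>y z. adj z y) (u # q1 @ [x])"
    by (rule successively_mono) (rule sympD[OF \<open>symp adj\<close>])
  then have "successively adj (rev (u # q1 @ [x]))"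
    unfolding successively_rev .
  then have down: "successively adj ((x # t) @ [u])"
    by (simp only: t_def rev.simps rev_append append.simps)
  have "successively adj ?c"
    using up down unfolding successively_append_iff successively_Cons by (cases p1) simp_all
  moreover have "distinct ?c"
    using p q p1 assms(7,8) by (auto simp: p_eq q_eq t_def vertex_path_def)
  moreover have "adj (last ?c) (hd ?c)"
    using down unfolding successively_append_iff by simp
  \<comment> \<open>If both arms were empty, \<open>x\<close> would be equal to both
    \<open>a\<close> and \<open>b\<close>. So there is a third vertex besides \<open>u\<close> and
    \<open>x\<close>.\<close>
  moreover have "p1 \<noteq> [] \<or> t \<noteq> []"
    using p q \<open>a \<noteq> b\<close> by (auto simp: vertex_path_def p_eq q_eq t_def)
  then have "3 \<le> length ?c"
    by (cases p1; cases t) auto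
  ultimately show ?thesis
    unfolding graph_cycle_def by blast
qed

text \<open>If the paths took different first steps out of \<open>u\<close>, their tails, which
  avoid \<open>u\<close> and end in the same vertex, would yield a cycle.\<close>

lemma vertex_path_unique:
  assumes "tree adj" "vertex_path adj u p v" "vertex_path adj u q v"
  shows "p = q"
  using assms(2,3)
proof (induction p arbitrary: u q)
  case Nil
  then show ?case by (simp add: vertex_path_def)
next
  case (Cons x p)
  then obtain q' where q: "q = u # q'" and x: "x = u"
    by (cases q) (auto simp: vertex_path_def)
  \<comment> \<open>If one path is trivial, then \<open>v = u\<close>, and a longer path would visit
    \<open>u\<close> twice.\<close>
  have trivial: "p = [] \<longleftrightarrow> q' = []"
    using Cons.prems by (auto simp: vertex_path_def q x split: if_splits)
  show ?case
  proof (cases "p = []")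
    case True
    then show ?thesis using trivial q x by simp
  next
    case False
    with trivial Cons.prems
    have paths: "vertex_path adj (hd p) p v" "vertex_path adj (hd q') q' v"
      and u: "adj u (hd p)" "adj u (hd q')" "u \<notin> set p" "u \<notin> set q'"
      by (auto simp: vertex_path_def q x successively_Cons)
    have "hd p = hd q'"
      using graph_cycle_if_two_paths[OF _ paths u(1,2) _ u(3,4)] \<open>tree adj\<close>
      by (auto simp: tree_def)
    then show ?thesis using Cons.IH paths q x by metis
  qed
qed

lemma level_eq:
  assumes "tree adj" "vertex_path adj r p v"
  shows "level adj r v = length p - 1"
proof -
  have "(THE p. vertex_path adj r p v) = p"
    using assms(2) by (rule the_equality) (rule vertex_path_unique[OF assms(1) _ assms(2)])
  then show ?thesis by (simp add: level_def)
qed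

lemma level_root:
  assumes "tree adj"
  shows "level adj r r = 0"
  using level_eq[OF assms, of r "[r]" r] by (simp add: vertex_path_def)

text \<open>Take the path from \<open>r\<close> to \<open>w\<close>. Either it passes through
  \<open>v\<close>, and its initial segment is the path to \<open>v\<close>, or appending
  \<open>v\<close> gives that path.\<close>

lemma level_adjacent:
  assumes "tree adj" "adj v w"
  shows "level adj r v = level adj r w + 1 \<or> level adj r v \<le> level adj r w"
proof -
  obtain q where q: "vertex_path adj r q w"
    using \<open>tree adj\<close> by (meson tree_def)
  have "adj w v"
    using assms by (auto simp: tree_def dest: sympD)
  show ?thesis
  proof (cases "v \<in> set q")
    case True
    then obtain q1 q2 where q_eq: "q = q1 @ v # q2"
      by (meson split_list)
    then have "q = (q1 @ [v]) @ q2"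
      by simp
    then have "vertex_path adj r (q1 @ [v]) v"
      using q successively_append_iff[of adj "q1 @ [v]" q2]
      by (simp add: vertex_path_def hd_append split: if_splits)
    then show ?thesis
      using level_eq[OF \<open>tree adj\<close>] q by (fastforce simp: q_eq)
  next
    case False
    then have "vertex_path adj r (q @ [v]) v"
      using q \<open>adj w v\<close> by (auto simp: vertex_path_def successively_append_iff)
    moreover have "q \<noteq> []"
      using q by (simp add: vertex_path_def)
    ultimately show ?thesis
      using level_eq[OF \<open>tree adj\<close>] q by fastforce
  qed
qed

text \<open>The penultimate vertex of the path to \<open>v\<close> is a neighbour of smaller level.
  A neighbour of least level therefore also lies below \<open>v\<close>, and by
  \<open>level_adjacent\<close> exactly one step below.\<close>

lemma level_parent:
  assumes "tree adj" "v \<noteq> r"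
  shows "level adj r v = level adj r (parent adj r v) + 1"
proof -
  obtain p where p: "vertex_path adj r p v"
    using \<open>tree adj\<close> by (meson tree_def)
  then obtain p' where p': "p = p' @ [v]"
    by (metis vertex_path_def append_butlast_last_id)
  with p \<open>v \<noteq> r\<close> have "p' \<noteq> []"
    by (auto simp: vertex_path_def)
  with p p' have path: "vertex_path adj r p' (last p')" and "adj (last p') v"
    by (auto simp: vertex_path_def successively_append_iff)
  have less: "level adj r (last p') < level adj r v"
    using level_eq[OF \<open>tree adj\<close> p] level_eq[OF \<open>tree adj\<close> path] \<open>p' \<noteq> []\<close>
    by (cases p') (auto simp: p')
  have "last p' \<in> nbrs adj v"
    using \<open>tree adj\<close> \<open>adj (last p') v\<close> by (auto simp: tree_def nbrs_def dest: sympD)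
  from arg_min_nat_lemma[of "\<lambda>w. w \<in> nbrs adj v", OF this, of "level adj r"]
  have "adj v (parent adj r v)" "level adj r (parent adj r v) \<le> level adj r (last p')"
    using \<open>last p' \<in> nbrs adj v\<close> by (auto simp: parent_def nbrs_def)
  with level_adjacent[OF \<open>tree adj\<close>] less show ?thesis
    by (meson leD le_less_trans)
qed

section \<open>Norm estimates\<close>

text \<open>Links the finiteness conditions, stated in the extended reals, to the boundedness
  required by real suprema.\<close>

lemma SUP_ereal_less_infinity_iff:
  fixes h :: "'a \<Rightarrow> real"
  shows "(SUP x\<in>A. ereal (h x)) < \<infinity> \<longleftrightarrow> bdd_above (h ` A)"
proof
  assume "(SUP x\<in>A. ereal (h x)) < \<infinity>"
  then obtain n :: nat where n: "(SUP x\<in>A. ereal (h x)) < ereal (real n)"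
    using less_PInf_Ex_of_nat by auto
  have "h x \<le> real n" if "x \<in> A" for x
    using le_less_trans[OF SUP_upper[OF that, of "\<lambda>x. ereal (h x)"] n] by simp
  then show "bdd_above (h ` A)" by (rule bdd_aboveI2)
next
  assume "bdd_above (h ` A)"
  then obtain M where "\<And>x. x \<in> A \<Longrightarrow> h x \<le> M"
    by (auto simp: bdd_above_def)
  then have "(SUP x\<in>A. ereal (h x)) \<le> ereal M"
    by (intro SUP_least) simp
  then show "(SUP x\<in>A. ereal (h x)) < \<infinity>"
    by (rule le_less_trans) simp
qed

lemma ereal_SUP_of_bdd_above:
  fixes h :: "'a \<Rightarrow> real"
  assumes "A \<noteq> {}" "bdd_above (h ` A)"
  shows "ereal (SUP x\<in>A. h x) = (SUP x\<in>A. ereal (h x))"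
proof (rule ereal_SUP)
  obtain a where "a \<in> A" using assms(1) by blast
  \<comment> \<open>The element \<open>a\<close> excludes the value minus infinity, which is the
    extended supremum over the empty set.\<close>
  have real: "\<bar>s\<bar> \<noteq> \<infinity>" if "ereal (h a) \<le> s" "s < \<infinity>" for s
    using that by (cases s) auto
  show "\<bar>SUP x\<in>A. ereal (h x)\<bar> \<noteq> \<infinity>"
    using SUP_upper[OF \<open>a \<in> A\<close>, of "\<lambda>x. ereal (h x)"]
      iffD2[OF SUP_ereal_less_infinity_iff assms(2)] by (rule real)
qed

lemma L_inf_norm_upper:
  assumes "f \<in> L_inf"
  shows "cmod (f v) \<le> L_inf_norm f"
proof -
  have "bdd_above (range (\<lambda>v. cmod (f v)))"
    using assms by (auto simp: L_inf_def bounded_iff bdd_above_def)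
  then show ?thesis
    unfolding L_inf_norm_def by (rule cSUP_upper[OF UNIV_I])
qed

section \<open>Finiteness of the edge weights\<close>

definition edge_weight :: "('v \<Rightarrow> 'v \<Rightarrow> bool) \<Rightarrow> 'v \<Rightarrow> ('v \<Rightarrow> complex) \<Rightarrow> 'v \<Rightarrow> real" where
  "edge_weight adj r \<psi> v = real (level adj r v) * (cmod (\<psi> v) + cmod (\<psi> (parent adj r v)))"

lemma eta_eq:
  assumes "- {r} \<noteq> {}" "bdd_above (edge_weight adj r \<psi> ` (- {r}))"
  shows "eta adj r \<psi> = ereal (cmod (\<psi> r) + (SUP v\<in>-{r}. edge_weight adj r \<psi> v))"
  unfolding plus_ereal.simps(1)[symmetric] ereal_SUP_of_bdd_above[OF assms]
  by (simp add: eta_def edge_weight_def)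

text \<open>One direction drops the parent term. For the other, the level of \<open>v\<close>
  exceeds that of its parent by 1, which leaves one extra modulus of \<open>\<psi>\<close> at the
  parent, and \<open>\<psi>\<close> is bounded because levels off the root are at least 1.\<close>

lemma bdd_above_edge_weight_iff:
  assumes "tree adj"
  shows "bdd_above (edge_weight adj r \<psi> ` (- {r})) \<longleftrightarrow>
    bdd_above (range (\<lambda>v. real (level adj r v) * cmod (\<psi> v)))"
proof
  assume "bdd_above (edge_weight adj r \<psi> ` (- {r}))"
  then obtain M where M: "\<And>v. v \<noteq> r \<Longrightarrow> edge_weight adj r \<psi> v \<le> M"
    by (auto simp: bdd_above_def)
  \<comment> \<open>\<open>M\<close> says nothing about the root, where the product is 0.\<close>
  have "real (level adj r v) * cmod (\<psi> v) \<le> max M 0" for v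
  proof (cases "v = r")
    case True
    then show ?thesis using level_root[OF assms] by simp
  next
    case False
    have "real (level adj r v) * cmod (\<psi> v) \<le> edge_weight adj r \<psi> v"
      unfolding edge_weight_def by (intro mult_left_mono) auto
    with M[OF False] show ?thesis by simp
  qed
  then show "bdd_above (range (\<lambda>v. real (level adj r v) * cmod (\<psi> v)))"
    by (rule bdd_aboveI2)
next
  assume "bdd_above (range (\<lambda>v. real (level adj r v) * cmod (\<psi> v)))"
  then obtain M where M: "\<And>v. real (level adj r v) * cmod (\<psi> v) \<le> M"
    by (auto simp: bdd_above_def)
  have M': "cmod (\<psi> v) \<le> cmod (\<psi> r) + M" for v
  proof (cases "v = r")
    case True
    then show ?thesis using M[of r] level_root[OF assms] by simp
  next
    case False
    then have "1 * cmod (\<psi> v) \<le> real (level adj r v) * cmod (\<psi> v)"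
      using level_parent[OF assms] by (intro mult_right_mono) auto
    then show ?thesis using M[of v] norm_ge_zero[of "\<psi> r"] by linarith
  qed
  \<comment> \<open>Two copies of \<open>M\<close> bound the weighted moduli at \<open>v\<close> and
    its parent; \<open>M'\<close> for the extra modulus at the parent gives the rest.\<close>
  have "edge_weight adj r \<psi> v \<le> cmod (\<psi> r) + 3 * M" if "v \<in> - {r}" for v
  proof -
    let ?w = "parent adj r v"
    have "edge_weight adj r \<psi> v = real (level adj r v) * cmod (\<psi> v) +
        (real (level adj r ?w) * cmod (\<psi> ?w) + cmod (\<psi> ?w))"
      using level_parent[OF assms, of v r] that by (simp add: edge_weight_def algebra_simps)
    then show ?thesis using M[of v] M[of ?w] M'[of ?w] by linarith
  qed
  then show "bdd_above (edge_weight adj r \<psi> ` (- {r}))"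
    by (rule bdd_aboveI2)
qed

section \<open>Upper bound for the multiplication operator\<close>

lemma level_Dfun_mult_op_le:
  assumes "f \<in> L_inf"
  shows "real (level adj r v) * Dfun adj r (mult_op \<psi> f) v \<le> L_inf_norm f * edge_weight adj r \<psi> v"
proof -
  let ?w = "parent adj r v"
  have "Dfun adj r (mult_op \<psi> f) v \<le> cmod (\<psi> v) * cmod (f v) + cmod (\<psi> ?w) * cmod (f ?w)"
    unfolding Dfun_def mult_op_def by (metis norm_triangle_ineq4 norm_mult)
  also have "\<dots> \<le> cmod (\<psi> v) * L_inf_norm f + cmod (\<psi> ?w) * L_inf_norm f"
    by (intro add_mono mult_left_mono L_inf_norm_upper assms) auto
  finally have "real (level adj r v) * Dfun adj r (mult_op \<psi> f) v \<le>
      real (level adj r v) * (cmod (\<psi> v) * L_inf_norm f + cmod (\<psi> ?w) * L_inf_norm f)"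
    by (rule mult_left_mono) simp
  then show ?thesis by (simp add: edge_weight_def algebra_simps)
qed

lemma mult_op_in_Lip_w:
  assumes "f \<in> L_inf" "bdd_above (edge_weight adj r \<psi> ` (- {r}))"
  shows "mult_op \<psi> f \<in> Lip_w adj r"
proof -
  obtain M where M: "\<And>v. v \<noteq> r \<Longrightarrow> edge_weight adj r \<psi> v \<le> M"
    using assms(2) by (auto simp: bdd_above_def)
  have "0 \<le> L_inf_norm f"
    using norm_ge_zero L_inf_norm_upper[OF assms(1)] order_trans by blast
  then have "real (level adj r v) * Dfun adj r (mult_op \<psi> f) v \<le> L_inf_norm f * M"
    if "v \<in> - {r}" for v
    using that by (intro order_trans[OF level_Dfun_mult_op_le[OF assms(1)] mult_left_mono[OF M]]) auto
  then show ?thesis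
    unfolding Lip_w_def SUP_ereal_less_infinity_iff mem_Collect_eq by (rule bdd_aboveI2)
qed

lemma Lip_w_norm_mult_op_le:
  assumes "f \<in> L_inf" "bdd_above (edge_weight adj r \<psi> ` (- {r}))" "- {r} \<noteq> {}"
  shows "Lip_w_norm adj r (mult_op \<psi> f) \<le>
    (cmod (\<psi> r) + (SUP v\<in>-{r}. edge_weight adj r \<psi> v)) * L_inf_norm f"
proof -
  have "0 \<le> L_inf_norm f"
    using norm_ge_zero L_inf_norm_upper[OF assms(1)] order_trans by blast
  have "(SUP v\<in>-{r}. real (level adj r v) * Dfun adj r (mult_op \<psi> f) v) \<le>
      L_inf_norm f * (SUP v\<in>-{r}. edge_weight adj r \<psi> v)"
  proof (rule cSUP_least[OF assms(3)])
    fix v assume "v \<in> - {r}"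
    then have "edge_weight adj r \<psi> v \<le> (SUP v\<in>-{r}. edge_weight adj r \<psi> v)"
      using assms(2) by (rule cSUP_upper)
    then show "real (level adj r v) * Dfun adj r (mult_op \<psi> f) v \<le>
        L_inf_norm f * (SUP v\<in>-{r}. edge_weight adj r \<psi> v)"
      using level_Dfun_mult_op_le[OF assms(1)] \<open>0 \<le> L_inf_norm f\<close>
      by (meson mult_left_mono order_trans)
  qed
  moreover have "cmod (mult_op \<psi> f r) \<le> cmod (\<psi> r) * L_inf_norm f"
    by (simp add: mult_op_def norm_mult mult_left_mono L_inf_norm_upper[OF assms(1)])
  ultimately show ?thesis by (simp add: Lip_w_norm_def algebra_simps)
qed

text \<open>At zeros of \<open>\<psi>\<close> the factor \<open>sgn\<close> is 0, so the modulus is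
  at most 1 but need not be 1. This is enough to lie in the unit ball.\<close>

definition extremal :: "('v \<Rightarrow> 'v \<Rightarrow> bool) \<Rightarrow> 'v \<Rightarrow> ('v \<Rightarrow> complex) \<Rightarrow> 'v \<Rightarrow> complex" where
  "extremal adj r \<psi> v = (- 1) ^ level adj r v * cnj (sgn (\<psi> v))"

lemma norm_extremal_le: "cmod (extremal adj r \<psi> v) \<le> 1"
  by (simp add: extremal_def norm_mult norm_power norm_sgn)

lemma extremal_in_L_inf: "extremal adj r \<psi> \<in> L_inf"
  using norm_extremal_le[of adj r \<psi>] by (auto simp: L_inf_def bounded_iff)

lemma L_inf_norm_extremal_le: "L_inf_norm (extremal adj r \<psi>) \<le> 1"
  unfolding L_inf_norm_def by (rule cSUP_least) (auto simp: norm_extremal_le)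

lemma mult_op_extremal:
  "mult_op \<psi> (extremal adj r \<psi>) v = complex_of_real ((- 1) ^ level adj r v * cmod (\<psi> v))"
proof -
  have "\<psi> v * cnj (sgn (\<psi> v)) = complex_of_real (cmod (\<psi> v))"
  proof (cases "\<psi> v = 0")
    case False
    have "\<psi> v * cnj (sgn (\<psi> v)) = (\<psi> v * cnj (\<psi> v)) / complex_of_real (cmod (\<psi> v))"
      by (simp add: sgn_eq)
    also have "\<dots> = complex_of_real (cmod (\<psi> v))"
      using False by (simp add: complex_norm_square[symmetric] power2_eq_square)
    finally show ?thesis .
  qed simp
  then show ?thesis
    by (simp add: mult_op_def extremal_def mult.left_commute)
qed

lemma Dfun_mult_op_extremal:
  assumes "tree adj" "v \<noteq> r"
  shows "Dfun adj r (mult_op \<psi> (extremal adj r \<psi>)) v = cmod (\<psi> v) + cmod (\<psi> (parent adj r v))"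
proof -
  let ?w = "parent adj r v"
  \<comment> \<open>Both products are real, and by \<open>level_parent\<close> their signs are
    opposite, so the moduli add up.\<close>
  have "mult_op \<psi> (extremal adj r \<psi>) v - mult_op \<psi> (extremal adj r \<psi>) ?w =
      complex_of_real (- ((- 1) ^ level adj r ?w * (cmod (\<psi> v) + cmod (\<psi> ?w))))"
    by (simp add: mult_op_extremal level_parent[OF assms] algebra_simps)
  then show ?thesis
    unfolding Dfun_def by (simp only: norm_of_real) (simp add: abs_mult power_abs)
qed

lemma Lip_w_norm_mult_op_extremal:
  assumes "tree adj"
  shows "Lip_w_norm adj r (mult_op \<psi> (extremal adj r \<psi>)) =
    cmod (\<psi> r) + (SUP v\<in>-{r}. edge_weight adj r \<psi> v)"
  using assms
  by (simp add: Lip_w_norm_def mult_op_extremal level_root Dfun_mult_op_extremal edge_weight_def)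

section \<open>Boundedness criterion and value of the operator norm\<close>

theorem theorem5p1:
  fixes adj :: "'v \<Rightarrow> 'v \<Rightarrow> bool" and r :: 'v and \<psi> :: "'v \<Rightarrow> complex"
  assumes "infinite_tree adj"
  shows "(bounded_operator L_inf L_inf_norm (Lip_w adj r) (Lip_w_norm adj r) (mult_op \<psi>) \<longleftrightarrow>
            (SUP v. ereal (real (level adj r v) * cmod (\<psi> v))) < \<infinity>) \<and>
         (bounded_operator L_inf L_inf_norm (Lip_w adj r) (Lip_w_norm adj r) (mult_op \<psi>) \<longrightarrow>
            ereal (operator_norm L_inf L_inf_norm (Lip_w_norm adj r) (mult_op \<psi>)) = eta adj r \<psi>)"
proof -
  let ?bounded = "bounded_operator L_inf L_inf_norm (Lip_w adj r) (Lip_w_norm adj r) (mult_op \<psi>)"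
  let ?W = "edge_weight adj r \<psi>" and ?f = "extremal adj r \<psi>"
  have tree: "tree adj" and "infinite (UNIV :: 'v set)"
    using assms by (auto simp: infinite_tree_def)
  then have nonempty: "- {r} \<noteq> {}"
    by (metis Compl_eq_Diff_UNIV finite.emptyI infinite_remove)
  \<comment> \<open>Hence membership of the image of the single function \<open>?f\<close> in
    \<open>Lip_w\<close> already forces the weights to be bounded.\<close>
  have weight: "(\<lambda>v. real (level adj r v) * Dfun adj r (mult_op \<psi> ?f) v) ` (- {r}) = ?W ` (- {r})"
    by (intro image_cong) (auto simp: Dfun_mult_op_extremal[OF tree] edge_weight_def)
  have iff: "?bounded \<longleftrightarrow> bdd_above (?W ` (- {r}))"
  proof
    assume ?bounded
    then have "\<forall>f\<in>L_inf. mult_op \<psi> f \<in> Lip_w adj r"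
      unfolding bounded_operator_def by (rule conjunct1)
    then have "mult_op \<psi> ?f \<in> Lip_w adj r"
      using extremal_in_L_inf by (rule bspec)
    then show "bdd_above (?W ` (- {r}))"
      unfolding Lip_w_def mem_Collect_eq SUP_ereal_less_infinity_iff
      by (simp add: weight)
  next
    assume bdd: "bdd_above (?W ` (- {r}))"
    show ?bounded
      unfolding bounded_operator_def
    proof (intro conjI ballI allI exI)
      fix f assume "f \<in> (L_inf :: ('v \<Rightarrow> complex) set)"
      then show "mult_op \<psi> f \<in> Lip_w adj r"
        and "Lip_w_norm adj r (mult_op \<psi> f) \<le> (cmod (\<psi> r) + (SUP v\<in>-{r}. ?W v)) * L_inf_norm f"
        using mult_op_in_Lip_w[OF _ bdd] Lip_w_norm_mult_op_le[OF _ bdd nonempty] by auto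
    qed (simp_all add: mult_op_def algebra_simps)
  qed
  have "ereal (operator_norm L_inf L_inf_norm (Lip_w_norm adj r) (mult_op \<psi>)) = eta adj r \<psi>"
    if ?bounded
  proof -
    let ?H = "cmod (\<psi> r) + (SUP v\<in>-{r}. ?W v)"
    have bdd: "bdd_above (?W ` (- {r}))"
      using iff that by (rule iffD1)
    \<comment> \<open>Needed to pass from the bound \<open>?H * L_inf_norm f\<close> to
      \<open>?H\<close> on the unit ball.\<close>
    have "0 \<le> ?H"
    proof -
      obtain v where v: "v \<in> - {r}" using nonempty by blast
      have "0 \<le> ?W v" by (simp add: edge_weight_def)
      also have "\<dots> \<le> (SUP v\<in>-{r}. ?W v)"
        using v bdd by (rule cSUP_upper)
      finally show ?thesis by simp
    qed
    have upper: "Lip_w_norm adj r (mult_op \<psi> f) \<le> ?H" if "f \<in> L_inf" "L_inf_norm f \<le> 1" for f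
      using Lip_w_norm_mult_op_le[OF that(1) bdd nonempty] mult_left_le[OF that(2) \<open>0 \<le> ?H\<close>]
      by (rule order_trans)
    \<comment> \<open>The bound is attained at \<open>?f\<close>, so the supremum is a
      maximum.\<close>
    have "?H \<in> (\<lambda>f. Lip_w_norm adj r (mult_op \<psi> f)) ` {f \<in> L_inf. L_inf_norm f \<le> 1}"
      using extremal_in_L_inf L_inf_norm_extremal_le Lip_w_norm_mult_op_extremal[OF tree, of r \<psi>]
      by (intro image_eqI[of _ _ ?f]) auto
    then have "operator_norm L_inf L_inf_norm (Lip_w_norm adj r) (mult_op \<psi>) = ?H"
      unfolding operator_norm_def using upper by (intro cSup_eq_maximum) auto
    then show ?thesis
      using eta_eq[OF nonempty bdd] by simp
  qed
  then have norm_eq: "?bounded \<longrightarrow>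
      ereal (operator_norm L_inf L_inf_norm (Lip_w_norm adj r) (mult_op \<psi>)) = eta adj r \<psi>"
    by (rule impI)
  have "?bounded \<longleftrightarrow> (SUP v. ereal (real (level adj r v) * cmod (\<psi> v))) < \<infinity>"
    by (simp only: iff bdd_above_edge_weight_iff[OF tree] SUP_ereal_less_infinity_iff)
  then show ?thesis
    using norm_eq by (rule conjI)
qed

end
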